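(* Let $\mathcal{A}\in\mathbb{C}^{n\times n\times p}$ be a complex tensor and let $\mathcal{C}_{\mathcal{A}}=\mathcal{A}*\mathcal{A}^D*\mathcal{A}$ be the T-core of $\mathcal{A}$. Then $$\mathcal{N}_{\mathcal{A}}=\mathcal{A}-\mathcal{C}_{\mathcal{A}}$$ is a nilpotent tensor of T-index $k=\mathrm{Ind}_T(\mathcal{A})$.
   Context: For $\mathcal{A}\in\mathbb{C}^{m\times n\times p}$ let $A^{(1)},\dots,A^{(p)}\in\mathbb{C}^{m\times n}$ be its frontal slices. $\mathrm{bcirc}(\mathcal{A})$ is the $mp\times np$ block circulant matrix whose $(i,j)$ block ($1\le i,j\le p$) is $A^{(((i-j)\bmod p)+1)}$; $\mathrm{unfold}(\mathcal{A})$ is the $mp\times n$ matrix obtained by stacking $A^{(1)},\dots,A^{(p)}$ vertically, and $\mathrm{fold}$ is the inverse of $\mathrm{unfold}$. The T-product is $\mathcal{A}*\mathcal{B}=\mathrm{fold}(\mathrm{bcirc}(\mathcal{A})\,\mathrm{unfold}(\mathcal{B}))$; powers are with respect to $*$. A tensor $\mathcal{N}$ is nilpotent if $\mathcal{N}^s=\mathcal{O}$ for some positive integer $s$. The index $\mathrm{Ind}(A)$ of a square matrix $A$ is the smallest positive integer $k$ with $\mathrm{rank}(A^k)=\mathrm{rank}(A^{k+1})$, and the T-index is $\mathrm{Ind}_T(\mathcal{A})=\mathrm{Ind}(\mathrm{bcirc}(\mathcal{A}))$. The T-Drazin inverse $\mathcal{A}^D$ is the unique $\mathcal{X}\in\mathbb{C}^{n\times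 n\times p}$ with $\mathcal{A}^k*\mathcal{X}*\mathcal{A}=\mathcal{A}^k$, $\mathcal{X}*\mathcal{A}*\mathcal{X}=\mathcal{X}$, $\mathcal{A}*\mathcal{X}=\mathcal{X}*\mathcal{A}$, where $k=\mathrm{Ind}_T(\mathcal{A})$. *)

theory Defs
  imports "Jordan_Normal_Form.DL_Rank"
begin

text \<open>A tensor of size \<open>m \<times> n \<times> p\<close> (with \<open>p > 0\<close>) is the list of its \<open>p\<close> frontal slices, each an
  \<open>m \<times> n\<close> matrix. Slices are counted from 0, so \<open>A ! k\<close> is the slice usually written
  \<open>A\<^sup>(\<^sup>k\<^sup>+\<^sup>1\<^sup>)\<close>.\<close>

type_synonym tensor = "complex mat list"

definition carrier_tensor :: "nat \<Rightarrow> nat \<Rightarrow> nat \<Rightarrow> tensor set" where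
  "carrier_tensor m n p = {A. length A = p \<and> set A \<subseteq> carrier_mat m n}"

abbreviation trows :: "tensor \<Rightarrow> nat" where
  "trows A \<equiv> dim_row (hd A)"

abbreviation tcols :: "tensor \<Rightarrow> nat" where
  "tcols A \<equiv> dim_col (hd A)"

text \<open>The slice of block \<open>(i, j)\<close> has index \<open>(i - j) mod p\<close>; adding \<open>p\<close> avoids truncated
  subtraction, as \<open>j < p\<close>.\<close>

definition bcirc :: "tensor \<Rightarrow> complex mat" where
  "bcirc A = (let m = trows A; n = tcols A; p = length A in
     mat (m * p) (n * p)
       (\<lambda>(r, c). A ! ((r div m + p - c div n) mod p) $$ (r mod m, c mod n)))"

definition unfold_tensor :: "tensor \<Rightarrow> complex mat" where
  "unfold_tensor A = (let m = trows A in
     mat (m * length A) (tcols A) (\<lambda>(r, c). A ! (r div m) $$ (r mod m, c)))"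

text \<open>The number \<open>p\<close> of slices is an argument of \<open>fold_tensor\<close>, as it cannot be read off from
  the stacked matrix.\<close>

definition fold_tensor :: "nat \<Rightarrow> complex mat \<Rightarrow> tensor" where
  "fold_tensor p M = (let m = dim_row M div p in
     map (\<lambda>k. mat m (dim_col M) (\<lambda>(i, j). M $$ (k * m + i, j))) [0..<p])"

definition tprod :: "tensor \<Rightarrow> tensor \<Rightarrow> tensor" (infixl \<open>*\<^sub>T\<close> 70) where
  "A *\<^sub>T B = fold_tensor (length A) (bcirc A * unfold_tensor B)"

definition tminus :: "tensor \<Rightarrow> tensor \<Rightarrow> tensor" (infixl \<open>-\<^sub>T\<close> 65) where
  "A -\<^sub>T B = map2 (-) A B"

definition zero_tensor :: "nat \<Rightarrow> nat \<Rightarrow> nat \<Rightarrow> tensor" where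
  "zero_tensor m n p = replicate p (0\<^sub>m m n)"

text \<open>The unit of the T-product has the identity matrix as first slice and zeros elsewhere.\<close>

definition one_tensor :: "nat \<Rightarrow> nat \<Rightarrow> tensor" where
  "one_tensor n p = map (\<lambda>k. if k = 0 then 1\<^sub>m n else 0\<^sub>m n n) [0..<p]"

fun tpow :: "tensor \<Rightarrow> nat \<Rightarrow> tensor" (infixr \<open>^\<^sub>T\<close> 75) where
  "A ^\<^sub>T 0 = one_tensor (trows A) (length A)"
| "A ^\<^sub>T (Suc k) = A ^\<^sub>T k *\<^sub>T A"

definition tnilpotent :: "tensor \<Rightarrow> bool" where
  "tnilpotent A \<longleftrightarrow> (\<exists>s>0. A ^\<^sub>T s = zero_tensor (trows A) (tcols A) (length A))"

definition mat_index :: "complex mat \<Rightarrow> nat" where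
  "mat_index M = (LEAST k. 0 < k \<and>
     vec_space.rank (dim_row M) (M ^\<^sub>m k) = vec_space.rank (dim_row M) (M ^\<^sub>m (k + 1)))"

definition t_index :: "tensor \<Rightarrow> nat" where
  "t_index A = mat_index (bcirc A)"

definition t_drazin :: "tensor \<Rightarrow> tensor" where
  "t_drazin A = (THE X. X \<in> carrier_tensor (trows A) (tcols A) (length A) \<and>
     A ^\<^sub>T t_index A *\<^sub>T X *\<^sub>T A = A ^\<^sub>T t_index A \<and>
     X *\<^sub>T A *\<^sub>T X = X \<and>
     A *\<^sub>T X = X *\<^sub>T A)"

definition t_core :: "tensor \<Rightarrow> tensor" where
  "t_core A = A *\<^sub>T t_drazin A *\<^sub>T A"

lemma fold_unfold_tensor:
  assumes A: "A \<in> carrier_tensor m n p" and p: "0 < p"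
  shows "fold_tensor p (unfold_tensor A) = A"
proof -
  have len: "length A = p" and sl: "\<And>k. k < p \<Longrightarrow> A ! k \<in> carrier_mat m n"
    using A by (auto simp: carrier_tensor_def)
  have hd: "hd A = A ! 0" using len p by (intro hd_conv_nth) auto
  have dims: "trows A = m" "tcols A = n" using sl[OF p] hd by auto
  have bound: "k * m + i < m * p" if "k < p" "i < m" for k i
  proof -
    have "k * m + i < Suc k * m" using that by simp
    also have "\<dots> \<le> p * m" using that by (intro mult_le_mono1) simp
    finally show ?thesis by (simp add: mult.commute)
  qed
  have "mat m n (\<lambda>(i, j). unfold_tensor A $$ (k * m + i, j)) = A ! k" if k: "k < p" for k
    using sl[OF k] bound[OF k]
    by (intro eq_matI) (auto simp: unfold_tensor_def dims len)
  moreover have "dim_row (unfold_tensor A) div p = m" "dim_col (unfold_tensor A) = n"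
    using p by (simp_all add: unfold_tensor_def dims len)
  ultimately show ?thesis
    by (intro nth_equalityI) (simp_all add: fold_tensor_def len)
qed

lemma unfold_fold_tensor:
  assumes M: "M \<in> carrier_mat (m * p) n" and p: "0 < p"
  shows "unfold_tensor (fold_tensor p M) = M"
proof -
  have d: "dim_row M div p = m" "dim_col M = n" using M p by auto
  let ?F = "fold_tensor p M"
  have len: "length ?F = p" by (simp add: fold_tensor_def d)
  have hd: "hd ?F = ?F ! 0" using len p by (intro hd_conv_nth) auto
  have dims: "trows ?F = m" "tcols ?F = n" using p by (simp_all add: hd) (simp_all add: fold_tensor_def d)
  have "?F ! (r div m) $$ (r mod m, c) = M $$ (r, c)" if "r < m * p" "c < n" for r c
  proof -
    have "m > 0" using that by (cases m) auto
    then have "r div m < p" "r mod m < m"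
      using that by (simp_all add: less_mult_imp_div_less mult.commute)
    then show ?thesis using that by (simp add: fold_tensor_def d)
  qed
  then show ?thesis using M by (intro eq_matI) (auto simp: unfold_tensor_def dims len)
qed

end

theory Submission
  imports Defs
begin

text \<open>The map \<^term>\<open>bcirc\<close> embeds the tensors of size \<open>n \<times> n \<times> p\<close> under the T-product into the ring of
  \<open>np \<times> np\<close> matrices (\<open>bcirc_tprod\<close>, \<open>bcirc_inject\<close>), and nilpotency, the T-index and the T-Drazin
  inverse all become the corresponding notions for the matrix \<open>M = bcirc A\<close>. So the statement is one
  about an element \<open>a\<close> of a ring with a Drazin inverse \<open>d\<close>. There \<open>e = 1 - da\<close> is an idempotent that
  commutes with \<open>a\<close>, and \<open>a - ada = ae\<close>; hence \<open>(a - ada)\<^sup>i = a\<^sup>i e\<close> for all \<open>i > 0\<close>. For \<open>i = k\<close>, the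
  index of \<open>a\<close>, this vanishes because \<open>a\<^sup>k d a = a\<^sup>k\<close>, which gives nilpotency.

  To treat the index in the ring, the rank condition is replaced by an algebraic one: two consecutive
  powers of \<open>M\<close> have the same rank iff \<open>M\<^sup>k = M\<^sup>k\<^sup>+\<^sup>1 Y\<close> for some matrix \<open>Y\<close> (\<open>rank_mult_eq_iff\<close>). If a power
  \<open>(ae)\<^sup>j\<close> with \<open>j > 0\<close> satisfies this condition, iterating it gives \<open>(ae)\<^sup>j = (ae)\<^sup>j\<^sup>+\<^sup>k y = 0\<close>, that is
  \<open>a\<^sup>j = a\<^sup>j\<^sup>+\<^sup>1 d\<close>, so \<open>a\<close> satisfies it at \<open>j\<close> too and \<open>k \<le> j\<close>; the converse bound is
  clear from \<open>(ae)\<^sup>k = 0\<close>.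

  The T-Drazin inverse is given by a definite description, so its existence and uniqueness have to be
  shown. Uniqueness is a computation in any monoid. For existence, ranks of powers stabilise on both
  sides: \<open>M\<^sup>k = M\<^sup>k\<^sup>+\<^sup>1 Y\<close> and, by transposition, \<open>M\<^sup>l = Z M\<^sup>l\<^sup>+\<^sup>1\<close>. For \<open>K = max k l\<close> the matrix
  \<open>M\<^sup>K Y\<^sup>K\<^sup>+\<^sup>1\<close> is then a Drazin inverse (\<open>drazin_exists\<close>). It is block circulant as soon as \<open>Y\<close> is, and
  \<open>Y\<close> can be taken block circulant: only its first block column matters, and this is the unfolding of
  a tensor (\<open>bcirc_right_factor\<close>).\<close>

section \<open>Rank and factorisation\<close>

context vec_space
begin

text \<open>A maximal independent set among the columns of \<open>B\<close> has \<open>rank B\<close> elements and stays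
  independent inside the span of the columns of \<open>A\<close>; this bounds its size, and when the bound is
  attained the set is a basis of that span.\<close>

lemma rank_cols_in_span:
  assumes A: "A \<in> carrier_mat n nc" and B: "B \<in> carrier_mat n nd"
    and sub: "set (cols B) \<subseteq> span (set (cols A))"
  shows rank_le_of_cols_in_span: "rank B \<le> rank A"
    and span_cols_le_of_rank_le: "rank A \<le> rank B \<Longrightarrow> span (set (cols A)) \<subseteq> span (set (cols B))"
proof -
  have cA: "set (cols A) \<subseteq> carrier_vec n" using cols_dim A by blast
  have cB: "set (cols B) \<subseteq> carrier_vec n" using cols_dim B by blast
  let ?W = "span (set (cols A))"
  have subW: "subspace class_ring ?W V" using cA span_is_subspace by simp
  have modW: "submodule class_ring ?W V" using cA span_is_submodule by simp
  interpret W: vectorspace class_ring "vs ?W" using subspace_is_vs[OF subW] .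
  obtain S where S: "maximal S (\<lambda>T. T \<subseteq> set (cols B) \<and> lin_indpt T)"
    using maximal_exists_superset[of "set (cols B)" "\<lambda>T. T \<subseteq> set (cols B) \<and> lin_indpt T" "{}"]
      finite_lin_indpt2[of "{}"] by auto
  then have SB: "S \<subseteq> set (cols B)" and liS: "lin_indpt S" by (auto simp: maximal_def)
  have rB: "rank B = card S" using rank_card_indpt[OF B S] .
  have SW: "S \<subseteq> ?W" using SB sub by auto
  have finS: "finite S" using SB finite_subset by blast
  have liW: "W.lin_indpt S" using span_li_not_depend(2)[OF SW modW] liS by simp
  have fdW: "W.fin_dim" using fin_dim_span_cols[OF A] .
  have SW': "S \<subseteq> carrier (vs ?W)" using SW by simp
  show "rank B \<le> rank A"
    unfolding rB unfolding rank_def using W.li_le_dim(2)[OF fdW SW' liW] .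
  assume "rank A \<le> rank B"
  then have "W.dim \<le> card S" unfolding rB unfolding rank_def .
  from W.dim_li_is_basis[OF fdW finS SW' liW this]
  have "W.span S = ?W" by (simp add: W.basis_def)
  then have "span S = ?W" using span_li_not_depend(1)[OF SW modW] by simp
  then show "?W \<subseteq> span (set (cols B))" using span_is_monotone[OF SB] by simp
qed

lemma cols_mult_in_span:
  assumes A: "A \<in> carrier_mat n nc" and B: "B \<in> carrier_mat nc nd"
  shows "set (cols (A * B)) \<subseteq> span (set (cols A))"
proof
  fix v assume "v \<in> set (cols (A * B))"
  then obtain j where j: "j < nd" "v = col (A * B) j"
    using B by (auto simp: cols_def)
  then have "v = A *\<^sub>v col B j" using col_mult2[OF A B] by simp
  moreover have "A *\<^sub>v col B j \<in> carrier_vec n" "col B j \<in> carrier_vec nc"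
    using A B j by auto
  ultimately have "v \<in> col_space A"
    using A by (subst col_space_eq[OF A]) auto
  then show "v \<in> span (set (cols A))" by (simp add: col_space_def)
qed

lemma rank_mult_le:
  assumes "A \<in> carrier_mat n nc" and "B \<in> carrier_mat nc nd"
  shows "rank (A * B) \<le> rank A"
  using assms by (intro rank_le_of_cols_in_span[where nc = nc and nd = nd] cols_mult_in_span) auto

text \<open>Equality of the ranks means that \<open>A\<close> and \<open>A B\<close> have the same column space; the columns of \<open>Y\<close>
  are the coefficients that express the columns of \<open>A\<close> by those of \<open>A B\<close>.\<close>

lemma rank_mult_eq_iff:
  assumes A: "A \<in> carrier_mat n nc" and B: "B \<in> carrier_mat nc nd"
  shows "rank A = rank (A * B) \<longleftrightarrow> (\<exists>Y \<in> carrier_mat nd nc. A = A * B * Y)"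
proof
  have AB: "A * B \<in> carrier_mat n nd" using A B by simp
  assume eq: "rank A = rank (A * B)"
  have "col A j \<in> col_space (A * B)" if "j < nc" for j
  proof -
    have "set (cols A) \<subseteq> span (set (cols A))"
      using cols_dim[of A] A by (intro in_own_span) simp
    also have "\<dots> \<subseteq> span (set (cols (A * B)))"
      using span_cols_le_of_rank_le[OF A AB cols_mult_in_span[OF A B]] eq by simp
    finally show ?thesis using that A by (auto simp: col_space_def cols_def)
  qed
  then have "\<forall>j<nc. \<exists>x. x \<in> carrier_vec nd \<and> (A * B) *\<^sub>v x = col A j"
    unfolding col_space_eq[OF AB] carrier_matD(2)[OF AB] by blast
  then obtain x where x: "\<And>j. j < nc \<Longrightarrow> x j \<in> carrier_vec nd"
    "\<And>j. j < nc \<Longrightarrow> (A * B) *\<^sub>v x j = col A j" by metis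
  define Y where "Y = mat_of_cols nd (map x [0..<nc])"
  have Y: "Y \<in> carrier_mat nd nc" using mat_of_cols_carrier(1)[of nd "map x [0..<nc]"] by (simp add: Y_def)
  have "A = A * B * Y"
  proof (rule mat_col_eqI)
    fix j assume "j < dim_col (A * B * Y)"
    then have j: "j < nc" using Y by simp
    have "col (A * B * Y) j = (A * B) *\<^sub>v col Y j" by (rule col_mult2[OF AB Y j])
    also have "col Y j = x j" using j x(1)[OF j] by (simp add: Y_def)
    finally show "col A j = col (A * B * Y) j" using x(2)[OF j] by simp
  qed (use A B Y in auto)
  then show "\<exists>Y \<in> carrier_mat nd nc. A = A * B * Y" using Y by blast
next
  assume "\<exists>Y \<in> carrier_mat nd nc. A = A * B * Y"
  then obtain Y where Y: "Y \<in> carrier_mat nd nc" "A = A * B * Y" by blast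
  have "rank A \<le> rank (A * B)"
    using rank_mult_le[of "A * B" nd Y nc] A B Y by simp
  then show "rank A = rank (A * B)" using rank_mult_le[OF A B] by simp
qed

end

section \<open>Drazin inverses in monoids and rings\<close>

context monoid
begin

text \<open>For a square matrix this is the condition that the \<open>k\<close>-th and the next power have equal rank.\<close>

definition right_stable :: "'a \<Rightarrow> nat \<Rightarrow> bool" where
  "right_stable a k \<longleftrightarrow> (\<exists>y \<in> carrier G. a [^] k = a [^] Suc k \<otimes> y)"

text \<open>The exponent is a parameter, since the equations make sense, and determine \<open>d\<close>, without any
  notion of index.\<close>

definition drazin :: "'a \<Rightarrow> nat \<Rightarrow> 'a \<Rightarrow> bool" where
  "drazin a k d \<longleftrightarrow> d \<in> carrier G \<and> a [^] k \<otimes> d \<otimes> a = a [^] k \<and> d \<otimes> a \<otimes> d = d \<and> a \<otimes> d = d \<otimes> a"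

lemma right_stable_iterate:
  assumes [simp]: "a \<in> carrier G" "y \<in> carrier G" and e: "a [^] k = a [^] Suc k \<otimes> y"
  shows "a [^] (k::nat) = a [^] (k + i) \<otimes> y [^] (i::nat)"
proof (induction i)
  case (Suc i)
  have "a [^] k = a [^] i \<otimes> a [^] k \<otimes> y [^] i"
    by (subst Suc) (simp add: nat_pow_mult add.commute)
  also have "\<dots> = a [^] i \<otimes> (a [^] Suc k \<otimes> y) \<otimes> y [^] i" by (subst e) simp
  also have "\<dots> = (a [^] i \<otimes> a [^] Suc k) \<otimes> (y \<otimes> y [^] i)" by (simp add: m_assoc del: nat_pow_Suc Group.nat_pow_Suc)
  also have "y \<otimes> y [^] i = y [^] Suc i" by (simp add: nat_pow_Suc2 del: nat_pow_Suc Group.nat_pow_Suc)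
  also have "a [^] i \<otimes> a [^] Suc k = a [^] (k + Suc i)"
    by (simp add: nat_pow_mult add.commute del: nat_pow_Suc Group.nat_pow_Suc)
  finally show ?case .
qed simp

lemma left_stable_iterate:
  assumes [simp]: "a \<in> carrier G" "z \<in> carrier G" and e: "a [^] k = z \<otimes> a [^] Suc k"
  shows "a [^] (k::nat) = z [^] (i::nat) \<otimes> a [^] (k + i)"
proof (induction i)
  case (Suc i)
  have "a [^] k = z [^] i \<otimes> (a [^] k \<otimes> a [^] i)"
    by (subst Suc) (simp add: nat_pow_mult)
  also have "\<dots> = z [^] i \<otimes> ((z \<otimes> a [^] Suc k) \<otimes> a [^] i)" by (subst e) simp
  also have "\<dots> = (z [^] i \<otimes> z) \<otimes> (a [^] Suc k \<otimes> a [^] i)" by (simp add: m_assoc del: nat_pow_Suc Group.nat_pow_Suc)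
  also have "a [^] Suc k \<otimes> a [^] i = a [^] (k + Suc i)"
    by (simp add: nat_pow_mult del: nat_pow_Suc Group.nat_pow_Suc)
  finally show ?case by simp
qed simp

lemma pow_shift_right:
  assumes [simp]: "a \<in> carrier G" "y \<in> carrier G" and e: "a [^] k = a [^] Suc k \<otimes> y" and "k \<le> (K::nat)"
  shows "a [^] K = a [^] Suc K \<otimes> y"
proof -
  obtain i where K: "K = i + k" using \<open>k \<le> K\<close> by (metis add.commute le_Suc_ex)
  have "a [^] K = a [^] i \<otimes> (a [^] Suc k \<otimes> y)" unfolding K by (subst e[symmetric]) (simp add: nat_pow_mult)
  then show ?thesis unfolding K by (simp add: m_assoc[symmetric] nat_pow_mult del: nat_pow_Suc Group.nat_pow_Suc)
qed

lemma pow_shift_left: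
  assumes [simp]: "a \<in> carrier G" "z \<in> carrier G" and e: "a [^] k = z \<otimes> a [^] Suc k" and "k \<le> (K::nat)"
  shows "a [^] K = z \<otimes> a [^] Suc K"
proof -
  obtain i where K: "K = k + i" using \<open>k \<le> K\<close> le_Suc_ex by blast
  have "a [^] K = (z \<otimes> a [^] Suc k) \<otimes> a [^] i" unfolding K by (subst e[symmetric]) (simp add: nat_pow_mult)
  then show ?thesis unfolding K by (simp add: m_assoc nat_pow_mult del: nat_pow_Suc Group.nat_pow_Suc)
qed

text \<open>From \<open>a\<^sup>K = a\<^sup>K\<^sup>+\<^sup>i y\<^sup>i = z\<^sup>i a\<^sup>K\<^sup>+\<^sup>i\<close> one gets two expressions for the same element,
  \<open>d = a\<^sup>K y\<^sup>K\<^sup>+\<^sup>1 = z\<^sup>K\<^sup>+\<^sup>1 a\<^sup>K\<close>. The first computes \<open>a d\<close>, the second \<open>d a\<close>, and both give \<open>z\<^sup>K a\<^sup>K\<close>;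
  this is why stability is needed on both sides. The equation at the possibly smaller exponent \<open>k\<close>
  follows since \<open>a\<^sup>k\<close> is a right multiple of \<open>a\<^sup>K\<close>.\<close>

lemma drazin_exists:
  assumes a [simp]: "a \<in> carrier G" and y [simp]: "y \<in> carrier G" and z [simp]: "z \<in> carrier G"
    and ek: "a [^] k = a [^] Suc k \<otimes> y" and el: "a [^] l = z \<otimes> a [^] Suc l"
    and kK: "k \<le> K" and lK: "l \<le> (K::nat)"
  shows "drazin a k (a [^] K \<otimes> y [^] Suc K)"
proof -
  note right = right_stable_iterate[OF a y pow_shift_right[OF a y ek kK]]
  note left = left_stable_iterate[OF a z pow_shift_left[OF a z el lK]]
  define d where "d = a [^] K \<otimes> y [^] Suc K"
  have [simp]: "d \<in> carrier G" by (simp add: d_def)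
  have zz: "z [^] i \<otimes> (a [^] i \<otimes> a [^] K) = a [^] K" for i :: nat
    using left[of i, symmetric] by (simp add: nat_pow_mult add.commute)
  have yy: "a [^] K \<otimes> (a [^] i \<otimes> y [^] i) = a [^] K" for i :: nat
    using right[of i, symmetric] by (simp add: nat_pow_mult m_assoc[symmetric])
  have dz: "d = z [^] Suc K \<otimes> a [^] K"
  proof -
    have "d = (z [^] Suc K \<otimes> (a [^] Suc K \<otimes> a [^] K)) \<otimes> y [^] Suc K" unfolding zz d_def ..
    also have "\<dots> = z [^] Suc K \<otimes> (a [^] K \<otimes> (a [^] Suc K \<otimes> y [^] Suc K))"
      by (simp add: m_assoc[symmetric] nat_pow_mult add.commute del: nat_pow_Suc Group.nat_pow_Suc)
    finally show ?thesis unfolding yy .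
  qed
  have ad: "a \<otimes> d = z [^] K \<otimes> a [^] K"
  proof -
    have a': "a \<otimes> a [^] K = a [^] K \<otimes> a" by (metis a nat_pow_Suc nat_pow_Suc2)
    have "a \<otimes> d = (a \<otimes> a [^] K) \<otimes> y [^] Suc K" by (simp add: d_def m_assoc del: nat_pow_Suc Group.nat_pow_Suc)
    also have "a \<otimes> a [^] K = z [^] K \<otimes> (a [^] K \<otimes> a [^] Suc K)"
      using arg_cong[OF zz[of K], of "\<lambda>t. t \<otimes> a"] by (simp add: m_assoc a')
    finally show ?thesis using yy[of "Suc K"] by (simp add: m_assoc del: nat_pow_Suc Group.nat_pow_Suc)
  qed
  have da: "d \<otimes> a = z [^] K \<otimes> a [^] K"
  proof -
    have "d \<otimes> a = z [^] K \<otimes> (z \<otimes> (a [^] K \<otimes> a))" unfolding dz by (simp add: m_assoc)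
    also have "z \<otimes> (a [^] K \<otimes> a) = a [^] K" using pow_shift_left[OF a z el lK] by simp
    finally show ?thesis .
  qed
  have dad: "d \<otimes> a \<otimes> d = d"
  proof -
    have "d \<otimes> a \<otimes> d = z [^] K \<otimes> (a [^] K \<otimes> a [^] K) \<otimes> y [^] Suc K"
      unfolding da by (simp add: d_def m_assoc del: nat_pow_Suc Group.nat_pow_Suc)
    then show ?thesis unfolding zz by (simp add: d_def)
  qed
  have comm: "a [^] i \<otimes> (d \<otimes> a) = d \<otimes> a \<otimes> a [^] i" for i :: nat
  proof -
    have "(d \<otimes> a) \<otimes> a = a \<otimes> (d \<otimes> a)" using ad da by (metis \<open>d \<in> carrier G\<close> a m_assoc)
    then show ?thesis using group_commutes_pow[of a "d \<otimes> a" i] by simp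
  qed
  have "d \<otimes> a \<otimes> a [^] k = a [^] k"
  proof -
    have k: "a [^] k = a [^] K \<otimes> y [^] (K - k)"
      using right_stable_iterate[OF a y ek, of "K - k"] kK by simp
    have "d \<otimes> a \<otimes> a [^] K = a [^] K" unfolding da using zz[of K] by (simp add: m_assoc)
    then show ?thesis unfolding k by (simp add: m_assoc[symmetric])
  qed
  then show ?thesis unfolding drazin_def d_def[symmetric]
    using comm[of k] dad ad da by (simp add: m_assoc)
qed

text \<open>Iterating \<open>u = a u u\<close> writes a Drazin inverse \<open>u\<close> as \<open>a\<^sup>k u\<^sup>k\<^sup>+\<^sup>1 = u\<^sup>k\<^sup>+\<^sup>1 a\<^sup>k\<close>. Since \<open>a x\<close> fixes \<open>a\<^sup>k\<close> from
  either side, for any other Drazin inverse \<open>x\<close>, it fixes \<open>u\<close> from either side as well. Hence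
  \<open>d = a d' d = d' a d = d'\<close>.\<close>

lemma drazin_unique:
  assumes a [simp]: "a \<in> carrier G" and d: "drazin a k d" and d': "drazin a k d'"
  shows "d = d'"
proof -
  have c [simp]: "x \<in> carrier G" if "drazin a k x" for x using that by (simp add: drazin_def)
  have power: "x = a [^] i \<otimes> x [^] Suc i" if x: "drazin a k x" for x and i :: nat
  proof (induction i)
    case (Suc i)
    have "x = a \<otimes> x \<otimes> x" using x by (metis drazin_def)
    also have "\<dots> = a \<otimes> (a [^] i \<otimes> x [^] Suc i) \<otimes> x" using Suc by simp
    also have "\<dots> = (a \<otimes> a [^] i) \<otimes> (x [^] Suc i \<otimes> x)"
      using x by (simp add: m_assoc)
    also have "\<dots> = a [^] Suc i \<otimes> x [^] Suc (Suc i)"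
      by (simp only: nat_pow_Suc2[OF a, symmetric] nat_pow_Suc[of x, symmetric])
    finally show ?case .
  qed (use x in simp)
  have ax: "a [^] k \<otimes> (a \<otimes> x) = a [^] k" "(a \<otimes> x) \<otimes> a [^] k = a [^] k" if x: "drazin a k x" for x
  proof -
    have [simp]: "x \<in> carrier G" using x by simp
    have xa: "a \<otimes> x = x \<otimes> a" and e: "a [^] k \<otimes> x \<otimes> a = a [^] k"
      using x by (simp_all add: drazin_def)
    show r: "a [^] k \<otimes> (a \<otimes> x) = a [^] k" using e unfolding xa by (simp add: m_assoc)
    have "a \<otimes> (a \<otimes> x) = (a \<otimes> x) \<otimes> a" using xa by (metis a \<open>x \<in> carrier G\<close> m_assoc)
    then show "(a \<otimes> x) \<otimes> a [^] k = a [^] k"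
      using group_commutes_pow[of a "a \<otimes> x" k] r by simp
  qed
  have absorb_left: "(a \<otimes> x) \<otimes> u = u" if x: "drazin a k x" and u: "drazin a k u" for x u
  proof -
    have "(a \<otimes> x) \<otimes> (a [^] k \<otimes> u [^] Suc k) = ((a \<otimes> x) \<otimes> a [^] k) \<otimes> u [^] Suc k"
      using x u by (simp add: m_assoc del: nat_pow_Suc Group.nat_pow_Suc)
    then show ?thesis using power[OF u, of k] ax(2)[OF x] by simp
  qed
  have absorb_right: "u \<otimes> (a \<otimes> x) = u" if x: "drazin a k x" and u: "drazin a k u" for x u
  proof -
    have "a \<otimes> u = u \<otimes> a" using u by (simp add: drazin_def)
    then have "a [^] k \<otimes> u = u \<otimes> a [^] k" using u by (simp add: group_commutes_pow)
    then have "u [^] Suc k \<otimes> a [^] k = a [^] k \<otimes> u [^] Suc k"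
      using group_commutes_pow[of u "a [^] k" "Suc k"] u by simp
    then have ku: "u = u [^] Suc k \<otimes> a [^] k" using power[OF u, of k] by simp
    have "(u [^] Suc k \<otimes> a [^] k) \<otimes> (a \<otimes> x) = u [^] Suc k \<otimes> (a [^] k \<otimes> (a \<otimes> x))"
      using x u by (simp add: m_assoc del: nat_pow_Suc Group.nat_pow_Suc)
    then show ?thesis using ku ax(1)[OF x] by simp
  qed
  have "d = (a \<otimes> d') \<otimes> d" using absorb_left[OF d' d] by simp
  also have "\<dots> = (d' \<otimes> a) \<otimes> d" using d' by (simp add: drazin_def)
  also have "\<dots> = d' \<otimes> (a \<otimes> d)" using d d' by (simp add: m_assoc)
  also have "\<dots> = d'" using absorb_right[OF d d'] .
  finally show ?thesis .
qed

end

context ring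
begin

text \<open>The element \<open>a - a d a\<close> is \<open>a e\<close> for the idempotent \<open>e = 1 - d a\<close>, which commutes with \<open>a\<close>. At
  exponent 0 the formula would fail, as \<open>e\<^sup>0 = 1\<close>.\<close>

lemma drazin_nilpotent_part_pow:
  assumes a [simp]: "a \<in> carrier R" and d: "drazin a k d"
  shows "(a \<ominus> a \<otimes> d \<otimes> a) [^] Suc i = a [^] Suc i \<ominus> a [^] Suc i \<otimes> d \<otimes> a"
proof -
  have dc [simp]: "d \<in> carrier R" and ad: "a \<otimes> d = d \<otimes> a" and dad: "d \<otimes> a \<otimes> d = d"
    using d by (auto simp: drazin_def)
  define e where "e = \<one> \<ominus> d \<otimes> a"
  have ec [simp]: "e \<in> carrier R" by (simp add: e_def)
  have mult_e: "x \<otimes> e = x \<ominus> x \<otimes> d \<otimes> a" if "x \<in> carrier R" for x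
    using that by (simp add: e_def minus_eq r_distr r_minus m_assoc)
  have comm: "a \<otimes> e = e \<otimes> a"
  proof -
    have "e \<otimes> a = a \<ominus> d \<otimes> a \<otimes> a" by (simp add: e_def minus_eq l_distr l_minus)
    then show ?thesis by (simp add: mult_e ad)
  qed
  have "e \<otimes> d = \<zero>"
    by (simp add: e_def minus_eq l_distr l_minus dad r_neg)
  then have idem: "e \<otimes> e = e"
    by (simp add: mult_e minus_eq)
  have epow: "e [^] Suc j = e" for j by (induction j) (simp_all add: idem)
  have "(a \<otimes> e) [^] Suc i = a [^] Suc i \<otimes> e"
    using pow_mult_distrib[OF comm a ec, of "Suc i"] unfolding epow .
  then show ?thesis by (simp add: mult_e del: nat_pow_Suc Group.nat_pow_Suc)
qed

lemma drazin_nilpotent_part_nilpotent: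
  assumes a [simp]: "a \<in> carrier R" and d: "drazin a k d" and k: "0 < k"
  shows "(a \<ominus> a \<otimes> d \<otimes> a) [^] k = \<zero>"
proof -
  obtain i where i: "k = Suc i" using k gr0_implies_Suc by blast
  have "a [^] Suc i \<otimes> d \<otimes> a = a [^] Suc i" using d by (simp add: drazin_def i)
  then show ?thesis
    unfolding i using drazin_nilpotent_part_pow[OF a d, of i] by (simp add: minus_eq r_neg del: nat_pow_Suc Group.nat_pow_Suc)
qed

text \<open>Stability of a nilpotent element at \<open>j\<close> makes its \<open>j\<close>-th power a multiple of arbitrarily high
  powers, hence zero; for \<open>a - a d a\<close> this says that \<open>d\<close> itself witnesses stability of \<open>a\<close> at \<open>j\<close>.\<close>

lemma right_stable_of_nilpotent_part:
  assumes a [simp]: "a \<in> carrier R" and d: "drazin a k d" and k: "0 < k" and j: "0 < j"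
    and st: "right_stable (a \<ominus> a \<otimes> d \<otimes> a) j"
  shows "right_stable a j"
proof -
  let ?n = "a \<ominus> a \<otimes> d \<otimes> a"
  have [simp]: "d \<in> carrier R" and ad: "a \<otimes> d = d \<otimes> a" using d by (auto simp: drazin_def)
  have n [simp]: "?n \<in> carrier R" by simp
  obtain y where y [simp]: "y \<in> carrier R" and e: "?n [^] j = ?n [^] Suc j \<otimes> y"
    using st by (auto simp: right_stable_def)
  have "?n [^] j = ?n [^] j \<otimes> ?n [^] k \<otimes> y [^] k"
    using right_stable_iterate[OF n y e, of k] unfolding nat_pow_mult[OF n, symmetric] .
  then have z: "?n [^] j = \<zero>" using drazin_nilpotent_part_nilpotent[OF a d k] by simp
  obtain i where i: "j = Suc i" using j gr0_implies_Suc by blast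
  have "a [^] j \<ominus> a [^] j \<otimes> d \<otimes> a = \<zero>"
    using z drazin_nilpotent_part_pow[OF a d, of i] by (simp only: i)
  then have "a [^] j = a [^] j \<otimes> d \<otimes> a" by simp
  also have "\<dots> = a [^] Suc j \<otimes> d" by (simp add: m_assoc ad)
  finally show ?thesis unfolding right_stable_def by (intro bexI[of _ d]) simp_all
qed

end

section \<open>The T-product as multiplication of block circulant matrices\<close>

lemma carrier_tensor_dims:
  assumes "A \<in> carrier_tensor m n p" and "0 < p"
  shows "length A = p" "trows A = m" "tcols A = n" "\<And>k. k < p \<Longrightarrow> A ! k \<in> carrier_mat m n"
proof -
  show l: "length A = p" and s: "\<And>k. k < p \<Longrightarrow> A ! k \<in> carrier_mat m n"
    using assms by (auto simp: carrier_tensor_def)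
  have "hd A = A ! 0" using l assms(2) by (intro hd_conv_nth) auto
  then show "trows A = m" "tcols A = n" using s[OF assms(2)] by auto
qed

lemma bcirc_carrier:
  assumes "A \<in> carrier_tensor m n p" and "0 < p"
  shows "bcirc A \<in> carrier_mat (m * p) (n * p)"
  by (simp add: bcirc_def Let_def carrier_tensor_dims[OF assms])

lemma bcirc_index:
  assumes "A \<in> carrier_tensor m n p" and "0 < p" and "r < m * p" and "c < n * p"
  shows "bcirc A $$ (r, c) = A ! ((r div m + p - c div n) mod p) $$ (r mod m, c mod n)"
  using assms(3,4) by (simp add: bcirc_def Let_def carrier_tensor_dims[OF assms(1,2)])

lemma unfold_tensor_carrier:
  assumes "A \<in> carrier_tensor m n p" and "0 < p"
  shows "unfold_tensor A \<in> carrier_mat (m * p) n"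
  by (simp add: unfold_tensor_def Let_def carrier_tensor_dims[OF assms])

lemma unfold_tensor_index:
  assumes "A \<in> carrier_tensor m n p" and "0 < p" and "r < m * p" and "c < n"
  shows "unfold_tensor A $$ (r, c) = A ! (r div m) $$ (r mod m, c)"
  using assms(3,4) by (simp add: unfold_tensor_def Let_def carrier_tensor_dims[OF assms(1,2)])

lemma unfold_tensor_inject:
  assumes "A \<in> carrier_tensor m n p" and "B \<in> carrier_tensor m n p" and "0 < p"
    and "unfold_tensor A = unfold_tensor B"
  shows "A = B"
  using assms fold_unfold_tensor by metis

lemma fold_tensor_carrier:
  assumes "M \<in> carrier_mat (m * p) n" and "0 < p"
  shows "fold_tensor p M \<in> carrier_tensor m n p"
  using assms by (auto simp: carrier_tensor_def fold_tensor_def)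

lemma tprod_carrier:
  assumes "A \<in> carrier_tensor m n p" and "B \<in> carrier_tensor n l p" and "0 < p"
  shows "A *\<^sub>T B \<in> carrier_tensor m l p"
  unfolding tprod_def carrier_tensor_dims(1)[OF assms(1,3)]
  using bcirc_carrier[OF assms(1,3)] unfold_tensor_carrier[OF assms(2,3)] assms(3)
  by (intro fold_tensor_carrier) auto

lemma unfold_tprod:
  assumes "A \<in> carrier_tensor m n p" and "B \<in> carrier_tensor n l p" and "0 < p"
  shows "unfold_tensor (A *\<^sub>T B) = bcirc A * unfold_tensor B"
  unfolding tprod_def carrier_tensor_dims(1)[OF assms(1,3)]
  using bcirc_carrier[OF assms(1,3)] unfold_tensor_carrier[OF assms(2,3)] assms(3)
  by (intro unfold_fold_tensor) auto

lemma block_index_less: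
  fixes m p :: nat
  assumes "k < p" "i < m"
  shows "k * m + i < m * p"
proof -
  have "k * m + i < Suc k * m" using assms by simp
  also have "\<dots> \<le> p * m" using assms by (intro mult_le_mono1) simp
  finally show ?thesis by (simp add: mult.commute)
qed

lemma sum_blocks:
  fixes f :: "nat \<Rightarrow> 'a :: comm_monoid_add"
  shows "(\<Sum>t<n * p. f t) = (\<Sum>s<p. \<Sum>u<n. f (s * n + u))"
proof -
  have "sum f {s * n..<s * n + n} = (\<Sum>u<n. f (s * n + u))" for s
    using sum.shift_bounds_nat_ivl[of f 0 "s * n" n]
    by (simp add: add.commute atLeast0LessThan)
  then show ?thesis
    using sum.nat_group[of f n p] by (simp add: mult.commute)
qed

text \<open>The next lemmas are about subtraction in \<open>\<int>/p\<close>, written on natural numbers as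
  \<open>(a + p - b) mod p\<close> like the block indices of a block circulant matrix.\<close>

lemma mod_diff_cases:
  fixes a b p :: nat
  assumes "a < p" "b < p"
  shows "(a + p - b) mod p = (if b \<le> a then a - b else a + p - b)"
proof (cases "b \<le> a")
  case True
  then have "a + p - b = (a - b) + p" by simp
  then show ?thesis using True assms by (simp only: mod_add_self2) simp
qed (use assms in simp)

lemma int_mod_diff:
  fixes a b p :: nat
  assumes "b \<le> p"
  shows "int ((a + p - b) mod p) = (int a - int b) mod int p"
proof -
  have "int (a + p - b) = (int a - int b) + int p" using assms by simp
  then show ?thesis by (simp only: zmod_int mod_add_self2)
qed

lemma mod_diff_diff:
  fixes a b s p :: nat
  assumes "b < p" and "s < p"
  shows "((a + p - b) mod p + p - (s + p - b) mod p) mod p = (a + p - s) mod p"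
proof -
  have "(s + p - b) mod p \<le> p" using assms by simp
  then have "int (((a + p - b) mod p + p - (s + p - b) mod p) mod p)
      = ((int a - int b) mod int p - (int s - int b) mod int p) mod int p"
    using assms by (simp only: int_mod_diff less_imp_le)
  also have "\<dots> = int ((a + p - s) mod p)"
    using assms by (simp add: mod_diff_eq int_mod_diff)
  finally show ?thesis by simp
qed

lemma mod_add_cases:
  fixes a b p :: nat
  assumes "a < p" "b < p"
  shows "(a + b) mod p = (if a + b < p then a + b else a + b - p)"
  using assms by (simp add: le_mod_geq)

lemma sum_mod_shift:
  fixes f :: "nat \<Rightarrow> 'a :: comm_monoid_add"
  assumes "b < p"
  shows "(\<Sum>s<p. f ((s + p - b) mod p)) = (\<Sum>s<p. f s)"
proof (rule sum.reindex_bij_witness[where j = "\<lambda>s. (s + p - b) mod p" and i = "\<lambda>s. (s + b) mod p"])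
  fix s assume "s \<in> {..<p}"
  then have s: "s < p" by simp
  note s1 = mod_diff_cases[OF s assms] and s2 = mod_add_cases[OF s assms]
  have p: "0 < p" using s by simp
  show "((s + p - b) mod p + b) mod p = s"
    using s1 s assms mod_add_cases[of "(s + p - b) mod p" p b] p by (auto split: if_splits)
  show "((s + b) mod p + p - b) mod p = s"
    using s2 s assms mod_diff_cases[of "(s + b) mod p" p b] p by (auto split: if_splits)
qed (use assms in auto)

text \<open>Block \<open>(i, j)\<close> of the product of the block circulant matrices is a cyclic convolution that depends
  only on \<open>i - j\<close> modulo \<open>p\<close>: the substitution of \<open>s - j\<close> for the summation index \<open>s\<close> turns it into
  block \<open>(i - j, 0)\<close>, which is a slice of the T-product.\<close>

lemma bcirc_tprod:
  assumes A: "A \<in> carrier_tensor m n p" and B: "B \<in> carrier_tensor n l p" and p: "0 < p"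
  shows "bcirc (A *\<^sub>T B) = bcirc A * bcirc B"
proof (rule eq_matI)
  note AB = tprod_carrier[OF A B p]
  note cA = bcirc_carrier[OF A p] and cB = bcirc_carrier[OF B p] and cAB = bcirc_carrier[OF AB p]
    and uB = unfold_tensor_carrier[OF B p]
  fix r c assume "r < dim_row (bcirc A * bcirc B)" "c < dim_col (bcirc A * bcirc B)"
  then have r: "r < m * p" and c: "c < l * p" using cA cB by auto
  have m: "0 < m" and l: "0 < l" using r c by (auto intro: gr0I)
  have R: "r div m < p" "r mod m < m" and C: "c div l < p" "c mod l < l"
    using r c m l by (simp_all add: less_mult_imp_div_less mult.commute)
  \<comment> \<open>\<open>q\<close> is the slice that sits in the block of \<open>(r, c)\<close>, and \<open>g t s\<close> is the \<open>(r, c)\<close> entry within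
    the product of slice \<open>t\<close> of \<open>A\<close> with slice \<open>s\<close> of \<open>B\<close>.\<close>
  define q where "q = (r div m + p - c div l) mod p"
  have q: "q < p" using p by (simp add: q_def)
  define g where "g t s = (\<Sum>u<n. A ! t $$ (r mod m, u) * B ! s $$ (u, c mod l))" for t s
  have qr: "q * m + r mod m < m * p" using block_index_less q R by blast
  have "(bcirc A * bcirc B) $$ (r, c) = (\<Sum>t<n * p. bcirc A $$ (r, t) * bcirc B $$ (t, c))"
    using r c cA cB by (simp add: scalar_prod_def atLeast0LessThan)
  also have "\<dots> = (\<Sum>s<p. g ((r div m + p - s) mod p) ((s + p - c div l) mod p))"
    unfolding sum_blocks g_def
    by (intro sum.cong refl) (simp add: bcirc_index[OF A p] bcirc_index[OF B p] r c block_index_less)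
  also have "\<dots> = (\<Sum>s<p. g ((q + p - (s + p - c div l) mod p) mod p) ((s + p - c div l) mod p))"
  proof (intro sum.cong refl arg_cong2[where f = g])
    fix s assume "s \<in> {..<p}"
    then show "(r div m + p - s) mod p = (q + p - (s + p - c div l) mod p) mod p"
      using mod_diff_diff[OF C(1)] by (simp add: q_def)
  qed
  also have "\<dots> = (\<Sum>s<p. g ((q + p - s) mod p) s)"
    using sum_mod_shift[OF C(1), of "\<lambda>s. g ((q + p - s) mod p) s"] .
  also have "\<dots> = (\<Sum>t<n * p. bcirc A $$ (q * m + r mod m, t) * unfold_tensor B $$ (t, c mod l))"
    unfolding sum_blocks g_def using m
    by (intro sum.cong refl)
      (simp add: bcirc_index[OF A p] unfold_tensor_index[OF B p] qr C block_index_less)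
  also have "\<dots> = (bcirc A * unfold_tensor B) $$ (q * m + r mod m, c mod l)"
    using qr C cA uB by (simp add: scalar_prod_def atLeast0LessThan)
  also have "\<dots> = (A *\<^sub>T B) ! q $$ (r mod m, c mod l)"
    using m by (simp add: unfold_tprod[OF A B p, symmetric] unfold_tensor_index[OF AB p] qr C)
  also have "\<dots> = bcirc (A *\<^sub>T B) $$ (r, c)"
    by (simp add: bcirc_index[OF AB p] r c q_def)
  finally show "bcirc (A *\<^sub>T B) $$ (r, c) = (bcirc A * bcirc B) $$ (r, c)" ..
qed (use bcirc_carrier[OF tprod_carrier[OF A B p] p] bcirc_carrier[OF A p] bcirc_carrier[OF B p] in auto)

lemma one_tensor_carrier: "one_tensor n p \<in> carrier_tensor n n p"
  by (auto simp: one_tensor_def carrier_tensor_def)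

lemma one_tensor_nth: "k < p \<Longrightarrow> one_tensor n p ! k = (if k = 0 then 1\<^sub>m n else 0\<^sub>m n n)"
  by (simp add: one_tensor_def)

lemma bcirc_one_tensor:
  assumes p: "0 < p"
  shows "bcirc (one_tensor n p) = 1\<^sub>m (n * p)"
proof (rule eq_matI)
  fix r c assume "r < dim_row (1\<^sub>m (n * p))" "c < dim_col (1\<^sub>m (n * p))"
  then have r: "r < n * p" and c: "c < n * p" by auto
  then have n: "0 < n" by (auto intro: gr0I)
  have R: "r div n < p" "r mod n < n" and C: "c div n < p" "c mod n < n"
    using r c n by (simp_all add: less_mult_imp_div_less mult.commute)
  have rc: "r = c \<longleftrightarrow> r div n = c div n \<and> r mod n = c mod n"
    by (metis div_mult_mod_eq)
  have "(r div n + p - c div n) mod p = 0 \<longleftrightarrow> r div n = c div n"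
    using R C by (simp add: mod_diff_cases)
  then show "bcirc (one_tensor n p) $$ (r, c) = 1\<^sub>m (n * p) $$ (r, c)"
    using p R C r c by (simp add: bcirc_index[OF one_tensor_carrier p] one_tensor_nth rc)
qed (use bcirc_carrier[OF one_tensor_carrier p] in auto)

text \<open>Multiplying by the unfolded unit tensor selects the first block column.\<close>

lemma bcirc_times_unfold_one:
  assumes A: "A \<in> carrier_tensor m n p" and p: "0 < p"
  shows "bcirc A * unfold_tensor (one_tensor n p) = unfold_tensor A"
proof (rule eq_matI)
  fix r c assume "r < dim_row (unfold_tensor A)" "c < dim_col (unfold_tensor A)"
  then have r: "r < m * p" and c: "c < n" using unfold_tensor_carrier[OF A p] by auto
  have cp: "c < n * p" using c p by (metis less_le_trans mult.right_neutral mult_le_mono2 Suc_leI One_nat_def)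
  have e: "unfold_tensor (one_tensor n p) $$ (t, c) = (if t = c then 1 else 0)" if t: "t < n * p" for t
  proof -
    have n: "0 < n" and "t div n < p" "t mod n < n"
      using t c by (simp_all add: less_mult_imp_div_less mult.commute)
    moreover have "t = c \<longleftrightarrow> t div n = 0 \<and> t mod n = c"
      using c n by (auto simp: div_eq_0_iff)
    ultimately show ?thesis
      using t c by (simp add: unfold_tensor_index[OF one_tensor_carrier p] one_tensor_nth)
  qed
  have "(bcirc A * unfold_tensor (one_tensor n p)) $$ (r, c)
      = (\<Sum>t<n * p. bcirc A $$ (r, t) * unfold_tensor (one_tensor n p) $$ (t, c))"
    using r c bcirc_carrier[OF A p] unfold_tensor_carrier[OF one_tensor_carrier[of n p] p]
    by (simp add: scalar_prod_def atLeast0LessThan)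
  also have "\<dots> = (\<Sum>t<n * p. if t = c then bcirc A $$ (r, t) else 0)"
    by (intro sum.cong) (simp_all add: e)
  also have "\<dots> = bcirc A $$ (r, c)" using cp by simp
  also have "\<dots> = unfold_tensor A $$ (r, c)"
    using r c cp p
    by (simp add: bcirc_index[OF A p] unfold_tensor_index[OF A p] less_mult_imp_div_less mult.commute)
  finally show "(bcirc A * unfold_tensor (one_tensor n p)) $$ (r, c) = unfold_tensor A $$ (r, c)" .
qed (use bcirc_carrier[OF A p] unfold_tensor_carrier[OF A p] unfold_tensor_carrier[OF one_tensor_carrier[of n p] p] in auto)

lemma bcirc_inject:
  assumes "A \<in> carrier_tensor m n p" and "B \<in> carrier_tensor m n p" and "0 < p"
    and "bcirc A = bcirc B"
  shows "A = B"
  using assms bcirc_times_unfold_one unfold_tensor_inject by metis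

lemma bcirc_tminus:
  assumes A: "A \<in> carrier_tensor m n p" and B: "B \<in> carrier_tensor m n p" and p: "0 < p"
  shows tminus_carrier: "A -\<^sub>T B \<in> carrier_tensor m n p"
    and "bcirc (A -\<^sub>T B) = bcirc A - bcirc B"
proof -
  note dA = carrier_tensor_dims[OF A p] and dB = carrier_tensor_dims[OF B p]
  have nth: "(A -\<^sub>T B) ! k = A ! k - B ! k" if "k < p" for k
    using that dA(1) dB(1) by (simp add: tminus_def)
  show c: "A -\<^sub>T B \<in> carrier_tensor m n p"
  proof -
    have len: "length (A -\<^sub>T B) = p" using dA(1) dB(1) by (simp add: tminus_def)
    have "(A -\<^sub>T B) ! k \<in> carrier_mat m n" if "k < p" for k
      unfolding nth[OF that] using dB(4)[OF that] by (rule minus_carrier_mat)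
    then have "set (A -\<^sub>T B) \<subseteq> carrier_mat m n"
      using len by (auto simp: in_set_conv_nth)
    then show ?thesis using len by (simp add: carrier_tensor_def)
  qed
  show "bcirc (A -\<^sub>T B) = bcirc A - bcirc B"
  proof (rule eq_matI)
    fix r s assume "r < dim_row (bcirc A - bcirc B)" "s < dim_col (bcirc A - bcirc B)"
    then have r: "r < m * p" and s: "s < n * p" using bcirc_carrier[OF B p] by auto
    have "0 < m" "0 < n" using r s by (auto intro: gr0I)
    then show "bcirc (A -\<^sub>T B) $$ (r, s) = (bcirc A - bcirc B) $$ (r, s)"
      using r s p bcirc_carrier[OF B p] dA(4) dB(4)[of "(r div m + p - s div n) mod p"]
      by (simp add: bcirc_index[OF c p] bcirc_index[OF A p] bcirc_index[OF B p] nth)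
  qed (use bcirc_carrier[OF c p] bcirc_carrier[OF B p] in auto)
qed

lemma zero_tensor_carrier: "zero_tensor m n p \<in> carrier_tensor m n p"
  by (auto simp: zero_tensor_def carrier_tensor_def)

lemma bcirc_zero_tensor:
  assumes p: "0 < p"
  shows "bcirc (zero_tensor m n p) = 0\<^sub>m (m * p) (n * p)"
proof (rule eq_matI)
  fix r c assume "r < dim_row (0\<^sub>m (m * p) (n * p))" "c < dim_col (0\<^sub>m (m * p) (n * p))"
  then have "r < m * p" "c < n * p" by auto
  moreover from this have "0 < m" "0 < n" by (auto intro: gr0I)
  ultimately show "bcirc (zero_tensor m n p) $$ (r, c) = 0\<^sub>m (m * p) (n * p) $$ (r, c)"
    using p by (simp add: bcirc_index[OF zero_tensor_carrier p]) (simp add: zero_tensor_def)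
qed (use bcirc_carrier[OF zero_tensor_carrier p] in auto)

lemma bcirc_tpow:
  assumes A: "A \<in> carrier_tensor n n p" and p: "0 < p"
  shows tpow_carrier: "A ^\<^sub>T k \<in> carrier_tensor n n p"
    and "bcirc (A ^\<^sub>T k) = bcirc A ^\<^sub>m k"
proof -
  have "A ^\<^sub>T k \<in> carrier_tensor n n p \<and> bcirc (A ^\<^sub>T k) = bcirc A ^\<^sub>m k"
  proof (induction k)
    case 0
    then show ?case
      using bcirc_carrier[OF A p]
      by (simp add: carrier_tensor_dims[OF A p] one_tensor_carrier bcirc_one_tensor[OF p])
  next
    case (Suc k)
    then show ?case using tprod_carrier[where m = n, OF _ A p] bcirc_tprod[where m = n, OF _ A p] by simp
  qed
  then show "A ^\<^sub>T k \<in> carrier_tensor n n p" "bcirc (A ^\<^sub>T k) = bcirc A ^\<^sub>m k" by auto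
qed

text \<open>In \<open>bcirc A = bcirc B * Y\<close> the first block column of \<open>Y\<close> already determines the first block column
  of \<open>bcirc A\<close>, hence \<open>A\<close>. Folding it gives a tensor \<open>X\<close> with \<open>A = B * X\<close>.\<close>

lemma bcirc_right_factor:
  assumes A: "A \<in> carrier_tensor m n p" and B: "B \<in> carrier_tensor m l p" and p: "0 < p"
    and Y: "Y \<in> carrier_mat (l * p) (n * p)" and eq: "bcirc A = bcirc B * Y"
  obtains X where "X \<in> carrier_tensor l n p" and "bcirc A = bcirc B * bcirc X"
proof
  let ?J = "unfold_tensor (one_tensor n p)"
  let ?X = "fold_tensor p (Y * ?J)"
  have J: "?J \<in> carrier_mat (n * p) n" using unfold_tensor_carrier[OF one_tensor_carrier p] .
  have YJ: "Y * ?J \<in> carrier_mat (l * p) n" using Y J by simp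
  show X: "?X \<in> carrier_tensor l n p" using fold_tensor_carrier[OF YJ p] .
  have "unfold_tensor A = bcirc B * (Y * ?J)"
    using bcirc_times_unfold_one[OF A p] bcirc_carrier[OF B p] Y J by (simp add: eq)
  also have "\<dots> = unfold_tensor (B *\<^sub>T ?X)"
    by (simp add: unfold_tprod[OF B X p] unfold_fold_tensor[OF YJ p])
  finally have "A = B *\<^sub>T ?X" using unfold_tensor_inject[OF A tprod_carrier[OF B X p] p] by simp
  then show "bcirc A = bcirc B * bcirc ?X" by (metis bcirc_tprod[OF B X p])
qed

section \<open>The index of a square matrix\<close>

abbreviation sqmat :: "nat \<Rightarrow> complex mat ring" where
  "sqmat N \<equiv> ring_mat TYPE(complex) N ()"

lemma right_stable_iff_rank:
  assumes M: "M \<in> carrier_mat N N"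
  shows "monoid.right_stable (sqmat N) M k \<longleftrightarrow>
    vec_space.rank N (M ^\<^sub>m k) = vec_space.rank N (M ^\<^sub>m (k + 1))"
proof -
  interpret R: ring "sqmat N" by (rule ring_mat)
  have "M ^\<^sub>m k \<in> carrier_mat N N" using M by simp
  from vec_space.rank_mult_eq_iff[OF this M] show ?thesis
    unfolding R.right_stable_def
    by (simp add: pow_mat_ring_pow[OF M, where b = "()", symmetric] ring_mat_simps
        del: Group.nat_pow_Suc)
qed

lemma mat_index_eq:
  assumes M: "M \<in> carrier_mat N N"
  shows "mat_index M = (LEAST k. 0 < k \<and> monoid.right_stable (sqmat N) M k)"
  using M by (simp add: mat_index_def right_stable_iff_rank[OF M])

text \<open>The ranks of the powers decrease, so any positive exponent at which the rank is minimal will do.\<close>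

lemma ex_right_stable:
  assumes M: "M \<in> carrier_mat N N"
  shows "\<exists>k>0. monoid.right_stable (sqmat N) M k"
proof -
  obtain k where k: "0 < k" and
    min: "\<And>j. 0 < j \<Longrightarrow> vec_space.rank N (M ^\<^sub>m k) \<le> vec_space.rank N (M ^\<^sub>m j)"
    using ex_has_least_nat[of "\<lambda>k. 0 < k" 1 "\<lambda>k. vec_space.rank N (M ^\<^sub>m k)"] by auto
  have "vec_space.rank N (M ^\<^sub>m k * M) \<le> vec_space.rank N (M ^\<^sub>m k)"
    using M by (intro vec_space.rank_mult_le[where nc = N and nd = N]) auto
  then have "monoid.right_stable (sqmat N) M k"
    using min[of "Suc k"] by (simp add: right_stable_iff_rank[OF M])
  then show ?thesis using k by blast
qed

lemma mat_index_right_stable: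
  assumes M: "M \<in> carrier_mat N N"
  shows "0 < mat_index M" "monoid.right_stable (sqmat N) M (mat_index M)"
  using LeastI_ex[OF ex_right_stable[OF M]] by (simp_all add: mat_index_eq[OF M])

lemma transpose_pow_mat:
  fixes M :: "'a :: comm_semiring_1 mat"
  assumes M: "M \<in> carrier_mat N N"
  shows "(transpose_mat M) ^\<^sub>m k = transpose_mat (M ^\<^sub>m k)"
proof (induction k)
  case (Suc k)
  interpret R: semiring "ring_mat TYPE('a) N ()" by (rule semiring_mat)
  have "M ^\<^sub>m k * M = M * M ^\<^sub>m k"
    using R.nat_pow_Suc2[of M k] R.nat_pow_Suc[of M k] M
    by (simp add: pow_mat_ring_pow[OF M, where b = "()", symmetric] ring_mat_simps)
  then show ?case using Suc M by (simp add: transpose_mult[of M N N "M ^\<^sub>m k" N])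
qed (use M in simp)

text \<open>Stability of the transpose on the right is stability on the left. The exponent obtained in this way
  need not be the one at which the matrix itself is stable on the right.\<close>

lemma ex_left_stable:
  fixes M :: "complex mat"
  assumes M: "M \<in> carrier_mat N N"
  shows "\<exists>l. \<exists>Z \<in> carrier_mat N N. M ^\<^sub>m l = Z * M ^\<^sub>m Suc l"
proof -
  interpret R: ring "sqmat N" by (rule ring_mat)
  have Mt: "transpose_mat M \<in> carrier_mat N N" using M by simp
  obtain l Y where Y: "Y \<in> carrier_mat N N"
    and e: "transpose_mat M ^\<^sub>m l = transpose_mat M ^\<^sub>m Suc l * Y"
    using ex_right_stable[OF Mt]
    by (auto simp: R.right_stable_def ring_mat_simps
        pow_mat_ring_pow[OF Mt, where b = "()"] simp del: pow_mat.simps R.nat_pow_Suc Group.nat_pow_Suc)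
  have P: "M ^\<^sub>m Suc l \<in> carrier_mat N N" using M pow_carrier_mat by blast
  have "transpose_mat (M ^\<^sub>m l) = transpose_mat (M ^\<^sub>m Suc l) * Y"
    using e unfolding transpose_pow_mat[OF M] .
  then have "M ^\<^sub>m l = transpose_mat (transpose_mat (M ^\<^sub>m Suc l) * Y)"
    by (metis transpose_transpose)
  also have "\<dots> = transpose_mat Y * M ^\<^sub>m Suc l"
    using P Y by (subst transpose_mult[of _ N N _ N]) auto
  finally show ?thesis using Y by (intro exI bexI[of _ "transpose_mat Y"]) auto
qed

section \<open>The T-Drazin inverse and the T-core\<close>

lemma bcirc_drazin_iff:
  assumes A: "A \<in> carrier_tensor n n p" and X: "X \<in> carrier_tensor n n p" and p: "0 < p"
  shows "monoid.drazin (sqmat (n * p)) (bcirc A) k (bcirc X) \<longleftrightarrow>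
    A ^\<^sub>T k *\<^sub>T X *\<^sub>T A = A ^\<^sub>T k \<and> X *\<^sub>T A *\<^sub>T X = X \<and> A *\<^sub>T X = X *\<^sub>T A"
proof -
  interpret R: ring "sqmat (n * p)" by (rule ring_mat)
  note inj = bcirc_inject[where m = n and n = n, OF _ _ p]
  note closed = tprod_carrier[where m = n and n = n and l = n, OF _ _ p] A X tpow_carrier[OF A p]
  note hom = bcirc_tprod[where m = n and n = n and l = n, OF _ _ p] bcirc_tpow(2)[OF A p]
  have eq_iff: "B = C \<longleftrightarrow> bcirc B = bcirc C"
    if "B \<in> carrier_tensor n n p" "C \<in> carrier_tensor n n p" for B C
    using inj[OF that] by blast
  show ?thesis
    using bcirc_carrier[OF X p] bcirc_carrier[OF A p]
    by (simp add: R.drazin_def eq_iff closed hom ring_mat_simps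
        pow_mat_ring_pow[OF bcirc_carrier[OF A p], where b = "()", symmetric])
qed

lemma ex_tensor_drazin:
  assumes A: "A \<in> carrier_tensor n n p" and p: "0 < p"
  shows "\<exists>X \<in> carrier_tensor n n p. monoid.drazin (sqmat (n * p)) (bcirc A) (t_index A) (bcirc X)"
proof -
  let ?N = "n * p" and ?M = "bcirc A" and ?k = "t_index A"
  interpret R: ring "sqmat ?N" by (rule ring_mat)
  have M: "?M \<in> carrier_mat ?N ?N" using bcirc_carrier[OF A p] .
  note pow = pow_mat_ring_pow[OF M, where b = "()"]
  obtain Y where Y: "Y \<in> carrier_mat ?N ?N" and eY: "?M ^\<^sub>m ?k = ?M ^\<^sub>m Suc ?k * Y"
    using mat_index_right_stable(2)[OF M]
    by (auto simp: R.right_stable_def t_index_def ring_mat_simps pow simp del: pow_mat.simps R.nat_pow_Suc Group.nat_pow_Suc)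
  \<comment> \<open>Replacing \<open>Y\<close> by a block circulant factor makes the Drazin inverse below block circulant.\<close>
  obtain B where B: "B \<in> carrier_tensor n n p" and eB: "?M ^\<^sub>m ?k = ?M ^\<^sub>m Suc ?k * bcirc B"
    using bcirc_right_factor[OF tpow_carrier[OF A p] tpow_carrier[OF A p] p Y, of ?k "Suc ?k"] eY
    unfolding bcirc_tpow(2)[OF A p] by blast
  obtain l Z where Z: "Z \<in> carrier_mat ?N ?N" and eZ: "?M ^\<^sub>m l = Z * ?M ^\<^sub>m Suc l"
    using ex_left_stable[OF M] by blast
  let ?K = "max ?k l"
  let ?X = "A ^\<^sub>T ?K *\<^sub>T B ^\<^sub>T Suc ?K"
  have X: "?X \<in> carrier_tensor n n p"
    using tprod_carrier[OF tpow_carrier[OF A p] tpow_carrier[OF B p] p] .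
  have cB: "bcirc B \<in> carrier_mat ?N ?N" using bcirc_carrier[OF B p] .
  have "R.drazin ?M ?k (?M [^]\<^bsub>sqmat ?N\<^esub> ?K \<otimes>\<^bsub>sqmat ?N\<^esub> bcirc B [^]\<^bsub>sqmat ?N\<^esub> Suc ?K)"
    by (rule R.drazin_exists[where l = l and z = Z])
      (use M cB Z eB eZ in \<open>simp_all add: ring_mat_simps pow del: pow_mat.simps R.nat_pow_Suc Group.nat_pow_Suc\<close>)
  also have "?M [^]\<^bsub>sqmat ?N\<^esub> ?K \<otimes>\<^bsub>sqmat ?N\<^esub> bcirc B [^]\<^bsub>sqmat ?N\<^esub> Suc ?K = bcirc ?X"
    unfolding bcirc_tprod[OF tpow_carrier[OF A p] tpow_carrier[OF B p] p]
      bcirc_tpow(2)[OF A p] bcirc_tpow(2)[OF B p] ring_mat_simps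
      pow pow_mat_ring_pow[OF cB, where b = "()"] ..
  finally show ?thesis using X by blast
qed

lemma t_drazin_drazin:
  assumes A: "A \<in> carrier_tensor n n p" and p: "0 < p"
  shows "t_drazin A \<in> carrier_tensor n n p"
    and "monoid.drazin (sqmat (n * p)) (bcirc A) (t_index A) (bcirc (t_drazin A))"
proof -
  interpret R: ring "sqmat (n * p)" by (rule ring_mat)
  let ?P = "\<lambda>X. X \<in> carrier_tensor n n p \<and> R.drazin (bcirc A) (t_index A) (bcirc X)"
  have M: "bcirc A \<in> carrier (sqmat (n * p))"
    using bcirc_carrier[OF A p] by (simp add: ring_mat_simps)
  have "\<exists>!X. ?P X"
    using ex_tensor_drazin[OF A p] R.drazin_unique[OF M] bcirc_inject[OF _ _ p] by metis
  moreover have "t_drazin A = (THE X. ?P X)"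
    unfolding t_drazin_def carrier_tensor_dims[OF A p]
    using bcirc_drazin_iff[OF A _ p] by (intro arg_cong[where f = The]) blast
  ultimately have "?P (t_drazin A)" using theI'[of ?P] by simp
  then show "t_drazin A \<in> carrier_tensor n n p"
    "R.drazin (bcirc A) (t_index A) (bcirc (t_drazin A))" by auto
qed

theorem theorem16:
  fixes A :: tensor and n p :: nat
  assumes "0 < n" and "0 < p"
    and "A \<in> carrier_tensor n n p"
  shows "tnilpotent (A -\<^sub>T t_core A) \<and> t_index (A -\<^sub>T t_core A) = t_index A"
proof -
  note p = assms(2) and A = assms(3)
  let ?N = "n * p" and ?D = "t_drazin A" and ?k = "t_index A"
  define T where "T = A -\<^sub>T t_core A"
  interpret R: ring "sqmat ?N" by (rule ring_mat)
  have D: "?D \<in> carrier_tensor n n p"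
    and dr: "R.drazin (bcirc A) ?k (bcirc ?D)" using t_drazin_drazin[OF A p] by auto
  have M: "bcirc A \<in> carrier_mat ?N ?N" using bcirc_carrier[OF A p] .
  then have MR: "bcirc A \<in> carrier (sqmat ?N)" by (simp add: ring_mat_simps)
  have AD: "A *\<^sub>T ?D \<in> carrier_tensor n n p" using tprod_carrier[OF A D p] .
  have core: "t_core A \<in> carrier_tensor n n p"
    unfolding t_core_def using tprod_carrier[OF AD A p] .
  have T: "T \<in> carrier_tensor n n p" unfolding T_def using tminus_carrier[OF A core p] .
  have k: "0 < ?k" unfolding t_index_def using mat_index_right_stable(1)[OF M] .
  have bT: "bcirc T \<in> carrier_mat ?N ?N" using bcirc_carrier[OF T p] .
  have cD: "bcirc ?D \<in> carrier_mat ?N ?N" using bcirc_carrier[OF D p] .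
  have minus: "B \<ominus>\<^bsub>sqmat ?N\<^esub> C = B - C" if "B \<in> carrier_mat ?N ?N" "C \<in> carrier_mat ?N ?N" for B C
  proof -
    have "(B - C) \<oplus>\<^bsub>sqmat ?N\<^esub> C = B" using that by (auto simp: ring_mat_simps)
    then show ?thesis
      using that R.minus_eq R.add.m_assoc[of "B - C" C "\<ominus>\<^bsub>sqmat ?N\<^esub> C"] R.r_neg[of C]
        R.r_zero[of "B - C"] R.a_inv_closed[of C]
      by (metis minus_carrier_mat ring_mat_simps(5))
  qed
  have decomp: "bcirc T = bcirc A \<ominus>\<^bsub>sqmat ?N\<^esub> bcirc A \<otimes>\<^bsub>sqmat ?N\<^esub> bcirc ?D \<otimes>\<^bsub>sqmat ?N\<^esub> bcirc A"
    unfolding T_def bcirc_tminus(2)[OF A core p] unfolding t_core_def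
      bcirc_tprod[OF AD A p] bcirc_tprod[OF A D p] ring_mat_simps
    using M cD by (intro minus[symmetric]) auto
  have pow0: "bcirc T ^\<^sub>m ?k = 0\<^sub>m ?N ?N"
    using R.drazin_nilpotent_part_nilpotent[OF MR dr k]
    unfolding decomp[symmetric] pow_mat_ring_pow[OF bT, where b = "()"] by (simp add: ring_mat_simps)
  have "T ^\<^sub>T ?k = zero_tensor n n p"
    using bcirc_inject[OF tpow_carrier[OF T p] zero_tensor_carrier p]
    by (simp add: bcirc_tpow(2)[OF T p] bcirc_zero_tensor[OF p] pow0)
  then have "tnilpotent T"
    unfolding tnilpotent_def carrier_tensor_dims[OF T p] using k by blast
  moreover have "t_index T = ?k"
    unfolding t_index_def[of T] mat_index_eq[OF bT]
  proof (rule Least_equality)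
    have "bcirc T ^\<^sub>m ?k = bcirc T ^\<^sub>m Suc ?k * 0\<^sub>m ?N ?N"
      using bT by (simp add: pow0)
    then show "0 < ?k \<and> R.right_stable (bcirc T) ?k"
      using k unfolding R.right_stable_def ring_mat_simps pow_mat_ring_pow[OF bT, where b = "()"]
      by (intro conjI bexI[of _ "0\<^sub>m ?N ?N"]) auto
  next
    fix j assume j: "0 < j \<and> R.right_stable (bcirc T) j"
    then have "R.right_stable (bcirc A) j"
      using R.right_stable_of_nilpotent_part[OF MR dr k] unfolding decomp by blast
    then show "?k \<le> j"
      unfolding t_index_def mat_index_eq[OF M] using j by (intro Least_le) auto
  qed
  ultimately show ?thesis unfolding T_def by simp
qed

end
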